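(* Let $\lambda>0$, let $F^V$ be a distribution function with density $f>0$ on $[v_{\min},v_{\max}]$, let $T(\rho)=\int_\rho^{v_{\max}}(1-F^V(x))\,dx$, and let $0<c_w<\lambda T(v_{\min})$ (the interior regime). Let $\rho^\star\in(v_{\min},v_{\max})$ be the unique solution of $$\lambda\int_{\rho^\star}^{v_{\max}}\bigl(1-F^V(x)\bigr)\,dx=c_w.$$ Then $\rho^\star$ is strictly increasing in the arrival rate $\lambda$, strictly decreasing in the delay price $c_w$, and non-decreasing under a first-order stochastic improvement of the mark distribution $F^V$.
   Context: A first-order stochastic improvement replaces $F^V_1$ by $F^V_2$ (of the same type on $[v_{\min},v_{\max}]$) with $F^V_2(x)\le F^V_1(x)$ for all $x$. Monotonicity in $\lambda$ and $c_w$ is understood within the set of parameters satisfying $0<c_w<\lambda T(v_{\min})$. *)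

theory Defs
  imports "HOL-Probability.Probability"
begin

definition cdf_with_density :: "real \<Rightarrow> real \<Rightarrow> (real \<Rightarrow> real) \<Rightarrow> (real \<Rightarrow> real) \<Rightarrow> bool" where
  "cdf_with_density vmin vmax f F \<longleftrightarrow>
     f \<in> borel_measurable borel \<and>
     (\<forall>x\<in>{vmin..vmax}. 0 < f x) \<and> (\<forall>x. x \<notin> {vmin..vmax} \<longrightarrow> f x = 0) \<and>
     prob_space (density lborel (\<lambda>x. ennreal (f x))) \<and>
     F = cdf (density lborel (\<lambda>x. ennreal (f x)))"

definition tail_integral :: "real \<Rightarrow> (real \<Rightarrow> real) \<Rightarrow> real \<Rightarrow> real" where
  "tail_integral vmax F \<rho> = integral {\<rho>..vmax} (\<lambda>x. 1 - F x)"

definition interior_regime ::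
    "real \<Rightarrow> real \<Rightarrow> (real \<Rightarrow> real) \<Rightarrow> real \<Rightarrow> real \<Rightarrow> bool" where
  "interior_regime vmin vmax F lam cw \<longleftrightarrow> 0 < lam \<and> 0 < cw \<and> cw < lam * tail_integral vmax F vmin"

definition is_threshold ::
    "real \<Rightarrow> real \<Rightarrow> (real \<Rightarrow> real) \<Rightarrow> real \<Rightarrow> real \<Rightarrow> real \<Rightarrow> bool" where
  "is_threshold vmin vmax F lam cw \<rho> \<longleftrightarrow>
     \<rho> \<in> {vmin<..<vmax} \<and> lam * tail_integral vmax F \<rho> = cw"

definition rho_star ::
    "real \<Rightarrow> real \<Rightarrow> (real \<Rightarrow> real) \<Rightarrow> real \<Rightarrow> real \<Rightarrow> real" where
  "rho_star vmin vmax F lam cw = (THE \<rho>. is_threshold vmin vmax F lam cw \<rho>)"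

text \<open>The improvement goes from \<open>F1\<close> to \<open>F2\<close>: the better distribution has the pointwise smaller
  distribution function.\<close>

definition fosd_improvement :: "(real \<Rightarrow> real) \<Rightarrow> (real \<Rightarrow> real) \<Rightarrow> bool" where
  "fosd_improvement F1 F2 \<longleftrightarrow> (\<forall>x. F2 x \<le> F1 x)"

end

theory Submission
  imports Defs
begin

text \<open>The tail integral \<open>T\<close> is continuous, vanishes at \<open>vmax\<close>, and is strictly decreasing, since the
  positive density forces \<open>F < 1\<close> to the left of \<open>vmax\<close>. The threshold is therefore the unique
  solution of \<open>T \<rho> = cw / lam\<close>, and each comparison of thresholds is a comparison of values of \<open>T\<close>.
  A smaller \<open>F\<close> has a pointwise larger \<open>T\<close>, so it keeps the parameters interior and moves the
  solution to the right.\<close>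

lemma cdf_with_density_mono:
  assumes "cdf_with_density vmin vmax f F"
  shows "mono F"
proof -
  let ?M = "density lborel (\<lambda>x. ennreal (f x))"
  have F: "F = cdf ?M" and "prob_space ?M"
    using assms by (auto simp: cdf_with_density_def)
  then interpret prob_space ?M by simp
  interpret finite_borel_measure ?M by unfold_locales simp
  show ?thesis
    unfolding F by (intro monoI cdf_nondecreasing)
qed

lemma cdf_with_density_le_1:
  assumes "cdf_with_density vmin vmax f F"
  shows "F x \<le> 1"
  using assms by (auto simp: cdf_with_density_def cdf_def prob_space.prob_le_1)

text \<open>If \<open>F x = 1\<close>, no mass lies to the right of \<open>x\<close>, so almost no
  point of \<open>{x<..vmax}\<close> can carry positive density. But \<open>f\<close> is positive on
  that whole interval, which has positive length.\<close>

lemma cdf_with_density_less_1: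
  assumes "cdf_with_density vmin vmax f F" and "vmin \<le> x" and "x < vmax"
  shows "F x < 1"
proof (rule ccontr)
  let ?M = "density lborel (\<lambda>x. ennreal (f x))"
  have meas: "f \<in> borel_measurable borel" and pos: "\<And>y. y \<in> {vmin..vmax} \<Longrightarrow> 0 < f y"
    and F: "F = cdf ?M" and "prob_space ?M"
    using assms(1) by (auto simp: cdf_with_density_def)
  then interpret prob_space ?M by simp
  assume "\<not> F x < 1"
  then have "prob {..x} = 1"
    using prob_le_1[of "{..x}"] by (simp add: F cdf_def)
  then have "AE y in ?M. y \<in> {..x}"
    using prob_eq_1[of "{..x}"] by simp
  then have "AE y in lborel. 0 < f y \<longrightarrow> y \<le> x"
    using meas by (simp add: AE_density)
  then have "AE y in lborel. y \<notin> {x<..vmax}"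
    by eventually_elim (use pos assms(2) in force)
  \<comment> \<open>The exceptional set of the almost-everywhere statement is the interval
    itself.\<close>
  then have "emeasure lborel {x<..vmax} = 0"
    by (subst (asm) AE_iff_measurable[OF _ refl]) (auto simp: greaterThanAtMost_def greaterThan_def atMost_def Collect_conj_eq)
  then show False
    using assms(3) by simp
qed

lemma cdf_with_density_integrable:
  assumes "cdf_with_density vmin vmax f F"
  shows "(\<lambda>x. 1 - F x) integrable_on {a..b}"
proof -
  have "mono_on {a..b} F"
    using cdf_with_density_mono[OF assms] by (rule mono_imp_mono_on)
  then have "F integrable_on {a..b}"
    by (rule integrable_on_mono_on)
  then show ?thesis
    by (intro integrable_diff) auto
qed

lemma tail_integral_vmax: "tail_integral vmax F vmax = 0"
  by (simp add: tail_integral_def)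

lemma tail_integral_split:
  assumes "cdf_with_density vmin vmax f F" and "a \<le> b" and "b \<le> vmax"
  shows "tail_integral vmax F a = integral {a..b} (\<lambda>x. 1 - F x) + tail_integral vmax F b"
  unfolding tail_integral_def
  using Henstock_Kurzweil_Integration.integral_combine[OF assms(2,3) cdf_with_density_integrable[OF assms(1)]]
  by simp

lemma tail_integral_strict_antimono:
  assumes F: "cdf_with_density vmin vmax f F" and "vmin \<le> a" and "a < b" and "b \<le> vmax"
  shows "tail_integral vmax F b < tail_integral vmax F a"
proof -
  \<comment> \<open>Bounding at the midpoint covers \<open>b = vmax\<close>, where \<open>1 - F b\<close> may vanish.\<close>
  define m where "m = (a + b) / 2"
  have m: "a < m" "m < b"
    using assms(3) by (auto simp: m_def)
  have "0 < (m - a) * (1 - F m)"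
    using m assms cdf_with_density_less_1[OF F, of m] by simp
  also have "\<dots> = integral {a..m} (\<lambda>_. 1 - F m)"
    using m by simp
  also have "\<dots> \<le> integral {a..m} (\<lambda>x. 1 - F x)"
    using cdf_with_density_mono[OF F]
    by (intro integral_le cdf_with_density_integrable[OF F]) (auto dest: monoD)
  finally have "0 < integral {a..m} (\<lambda>x. 1 - F x)" .
  moreover have "0 \<le> integral {m..b} (\<lambda>x. 1 - F x)"
    using cdf_with_density_le_1[OF F]
    by (intro integral_nonneg cdf_with_density_integrable[OF F]) auto
  ultimately show ?thesis
    using tail_integral_split[OF F, of a m] tail_integral_split[OF F, of m b] m assms(4) by simp
qed

lemma tail_integral_less_iff:
  assumes "cdf_with_density vmin vmax f F" and "a \<in> {vmin<..<vmax}" and "b \<in> {vmin<..<vmax}"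
  shows "tail_integral vmax F b < tail_integral vmax F a \<longleftrightarrow> a < b"
  using tail_integral_strict_antimono[OF assms(1), of a b]
    tail_integral_strict_antimono[OF assms(1), of b a] assms(2,3)
  by (cases a b rule: linorder_cases) auto

text \<open>Splitting at \<open>x\<close> turns the variable lower limit into a constant minus an
  indefinite integral, which is continuous in its upper limit.\<close>

lemma continuous_on_tail_integral:
  assumes F: "cdf_with_density vmin vmax f F"
  shows "continuous_on {vmin..vmax} (tail_integral vmax F)"
proof -
  let ?I = "\<lambda>x. integral {vmin..x} (\<lambda>t. 1 - F t)"
  have "continuous_on {vmin..vmax} (\<lambda>x. tail_integral vmax F vmin - ?I x)"
    by (intro continuous_intros indefinite_integral_continuous_1 cdf_with_density_integrable[OF F])
  then show ?thesis
    by (rule continuous_on_eq) (auto dest: tail_integral_split[OF F])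
qed

lemma tail_integral_mono_fosd:
  assumes "cdf_with_density vmin vmax f F" and "cdf_with_density vmin vmax f2 F2"
    and "fosd_improvement F F2"
  shows "tail_integral vmax F \<rho> \<le> tail_integral vmax F2 \<rho>"
  unfolding tail_integral_def using assms
  by (intro integral_le cdf_with_density_integrable) (auto simp: fosd_improvement_def)

lemma ex1_threshold:
  assumes "vmin < vmax" and F: "cdf_with_density vmin vmax f F"
    and "interior_regime vmin vmax F lam cw"
  shows "\<exists>!\<rho>. is_threshold vmin vmax F lam cw \<rho>"
proof -
  have lam: "0 < lam" and cw: "0 < cw" "cw < lam * tail_integral vmax F vmin"
    using assms(3) by (auto simp: interior_regime_def)
  have bounds: "0 < cw / lam" "cw / lam < tail_integral vmax F vmin"
    using lam cw by (auto simp: field_simps)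
  then obtain \<rho> where \<rho>: "vmin \<le> \<rho>" "\<rho> \<le> vmax" "tail_integral vmax F \<rho> = cw / lam"
    using IVT2'[of "tail_integral vmax F" vmax "cw / lam" vmin] assms(1)
      continuous_on_tail_integral[OF F] by (auto simp: tail_integral_vmax)
  \<comment> \<open>The intermediate value theorem only gives a point of the closed interval; the
    strict bounds on \<open>cw / lam\<close> exclude its ends.\<close>
  have "\<rho> \<noteq> vmin" "\<rho> \<noteq> vmax"
    using \<rho>(3) bounds by (auto simp: tail_integral_vmax)
  then have "is_threshold vmin vmax F lam cw \<rho>"
    using \<rho> lam by (auto simp: is_threshold_def)
  moreover have "a = b"
    if "is_threshold vmin vmax F lam cw a" "is_threshold vmin vmax F lam cw b" for a b
    using that lam tail_integral_less_iff[OF F, of a b] tail_integral_less_iff[OF F, of b a]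
    by (cases a b rule: linorder_cases) (auto simp: is_threshold_def)
  ultimately show ?thesis
    by blast
qed

lemma
  assumes "vmin < vmax" and "cdf_with_density vmin vmax f F"
    and "interior_regime vmin vmax F lam cw"
  shows rho_star_in: "rho_star vmin vmax F lam cw \<in> {vmin<..<vmax}"
    and tail_integral_rho_star: "tail_integral vmax F (rho_star vmin vmax F lam cw) = cw / lam"
  using theI'[OF ex1_threshold[OF assms]] assms(3)
  by (auto simp: rho_star_def is_threshold_def interior_regime_def field_simps)

text \<open>The threshold depends on the two parameters only through the ratio \<open>c / l\<close>,
  the value that the strictly decreasing tail integral takes there. Monotonicity in the rate and in
  the price both follow.\<close>

lemma rho_star_less_iff:
  assumes "vmin < vmax" and "cdf_with_density vmin vmax f F"
    and "interior_regime vmin vmax F l c" and "interior_regime vmin vmax F l' c'"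
  shows "rho_star vmin vmax F l c < rho_star vmin vmax F l' c' \<longleftrightarrow> c' / l' < c / l"
  using assms tail_integral_less_iff[OF assms(2), of "rho_star vmin vmax F l c" "rho_star vmin vmax F l' c'"]
  by (simp only: rho_star_in tail_integral_rho_star)

text \<open>This guarantees that \<open>rho_star\<close> for \<open>F2\<close> is a genuine
  solution, although interiority is assumed for \<open>F\<close> only.\<close>

lemma interior_regime_fosd:
  assumes "cdf_with_density vmin vmax f F" and "cdf_with_density vmin vmax f2 F2"
    and "fosd_improvement F F2" and "interior_regime vmin vmax F lam cw"
  shows "interior_regime vmin vmax F2 lam cw"
  using assms(4) tail_integral_mono_fosd[OF assms(1-3), of vmin]
  unfolding interior_regime_def by (meson less_le_trans less_imp_le mult_left_mono)

lemma rho_star_mono_fosd: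
  assumes "vmin < vmax" and F: "cdf_with_density vmin vmax f F"
    and F2: "cdf_with_density vmin vmax f2 F2"
    and fosd: "fosd_improvement F F2" and int: "interior_regime vmin vmax F lam cw"
  shows "rho_star vmin vmax F lam cw \<le> rho_star vmin vmax F2 lam cw"
proof -
  let ?r = "rho_star vmin vmax F lam cw" and ?r2 = "rho_star vmin vmax F2 lam cw"
  note int2 = interior_regime_fosd[OF F F2 fosd int]
  \<comment> \<open>Both sides equal \<open>cw / lam\<close>. Hence the tail integral of
    \<open>F2\<close> is at least as large at \<open>?r\<close> as at \<open>?r2\<close>, which
    rules out \<open>?r2 < ?r\<close>.\<close>
  have "tail_integral vmax F2 ?r2 = tail_integral vmax F ?r"
    using assms(1) F F2 int int2 by (simp add: tail_integral_rho_star)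
  also have "\<dots> \<le> tail_integral vmax F2 ?r"
    by (rule tail_integral_mono_fosd[OF F F2 fosd])
  finally show ?thesis
    using tail_integral_less_iff[OF F2 rho_star_in[OF assms(1) F2 int2] rho_star_in[OF assms(1) F int]]
    by linarith
qed

theorem proposition8:
  fixes vmin vmax lam cw :: real and f F :: "real \<Rightarrow> real"
  assumes "vmin < vmax"
    and "cdf_with_density vmin vmax f F"
    and "interior_regime vmin vmax F lam cw"
  shows "(\<exists>!\<rho>. is_threshold vmin vmax F lam cw \<rho>) \<and>
    strict_mono_on {l. interior_regime vmin vmax F l cw} (\<lambda>l. rho_star vmin vmax F l cw) \<and>
    strict_antimono_on {c. interior_regime vmin vmax F lam c} (\<lambda>c. rho_star vmin vmax F lam c) \<and>
    (\<forall>f2 F2. cdf_with_density vmin vmax f2 F2 \<and> fosd_improvement F F2 \<longrightarrow>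
       rho_star vmin vmax F lam cw \<le> rho_star vmin vmax F2 lam cw)"
proof (intro conjI allI impI)
  show "\<exists>!\<rho>. is_threshold vmin vmax F lam cw \<rho>"
    by (rule ex1_threshold[OF assms])
  show "strict_mono_on {l. interior_regime vmin vmax F l cw} (\<lambda>l. rho_star vmin vmax F l cw)"
    \<comment> \<open>Since \<open>cw\<close> is positive, a larger rate makes the ratio
      \<open>cw / l\<close> strictly smaller.\<close>
    using rho_star_less_iff[OF assms(1,2)]
    by (auto simp: strict_mono_on_def interior_regime_def intro!: divide_strict_left_mono)
  show "strict_antimono_on {c. interior_regime vmin vmax F lam c} (\<lambda>c. rho_star vmin vmax F lam c)"
    using rho_star_less_iff[OF assms(1,2)]
    by (auto simp: monotone_on_def interior_regime_def intro!: divide_strict_right_mono)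
  show "rho_star vmin vmax F lam cw \<le> rho_star vmin vmax F2 lam cw"
    if "cdf_with_density vmin vmax f2 F2 \<and> fosd_improvement F F2" for f2 F2
    using that rho_star_mono_fosd[OF assms(1,2) _ _ assms(3)] by blast
qed

end
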